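(* For every integer $k \ge 0$, the sequence $(A_{k+1}(\ell))_{1 \le \ell \le 2k+1}$ is unimodal; that is, there is an index $p \in \{1,\dots,2k+1\}$ with $A_{k+1}(1) \le A_{k+1}(2) \le \dots \le A_{k+1}(p) \ge A_{k+1}(p+1) \ge \dots \ge A_{k+1}(2k+1)$.
   Context: Permutations of length $n$ are permutations of $\{1,\dots,n\}$ written in one-line notation $\pi = \pi_1 \pi_2 \cdots \pi_n$; the first element of $\pi$ is $\pi_1$. West's stack-sorting map $s$ is defined recursively on finite words with distinct positive integer letters: $s$ of the empty word is the empty word, and if a nonempty word is written as $L\, N\, R$ where $N$ is its largest letter, then $s(L\,N\,R) = s(L)\, s(R)\, N$ (concatenation). It maps permutations of length $n$ to permutations of length $n$. A permutation $\pi$ of length $n$ is called uniquely sorted if there is exactly one permutation $\sigma$ of length $n$ with $s(\sigma) = \pi$, i.e. $|s^{-1}(\pi)| = 1$. For integers $k \ge 0$ and $1 \le \ell \le 2k+1$, $A_{k+1}(\ell)$ denotes the number of uniquely sorted permutations of length $2k+1$ whose first element is $\ell$. *)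

theory Defs
  imports Main "HOL-Combinatorics.Multiset_Permutations"
begin

text \<open>
  Permutations of length \<open>n\<close> in one-line notation are the elements of
  \<open>permutations_of_set {1..n}\<close>, i.e. the distinct lists with set of letters \<open>{1..n}\<close>.
\<close>

text \<open>
  HOL functions are total, so this is also defined on words with repeated letters, where
  the split is at the leftmost occurrence of the maximum.
\<close>
function stack_sort :: "nat list \<Rightarrow> nat list" where
  "stack_sort [] = []"
| "stack_sort (x # xs) =
     (let w = x # xs; N = Max (set w);
          L = takeWhile (\<lambda>y. y \<noteq> N) w;
          R = tl (dropWhile (\<lambda>y. y \<noteq> N) w)
      in stack_sort L @ stack_sort R @ [N])"
  by pat_completeness auto
termination
proof (relation "measure length", goal_cases)
  case 1
  show ?case by simp
next
  case (2 x xs w N L)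
  have "N \<in> set w" using 2 Max_in[of "set w"] by simp
  moreover have "set (takeWhile (\<lambda>y. y \<noteq> N) w) \<subseteq> {y. y \<noteq> N}"
    by (auto dest: set_takeWhileD)
  ultimately have "takeWhile (\<lambda>y. y \<noteq> N) w \<noteq> w" by auto
  then have "length (takeWhile (\<lambda>y. y \<noteq> N) w) < length w"
    by (metis length_takeWhile_le le_neq_implies_less takeWhile_eq_take take_all_iff le_refl)
  then show ?case using 2 by simp
next
  case (3 x xs w N L R)
  have "length (dropWhile (\<lambda>y. y \<noteq> N) w) \<le> length w"
    by (rule length_dropWhile_le)
  then show ?case using 3 by simp
qed

lemma stack_sort_split:
  assumes "\<And>y. y \<in> set L \<union> set R \<Longrightarrow> y < N"
  shows "stack_sort (L @ N # R) = stack_sort L @ stack_sort R @ [N]"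
proof -
  have M: "Max (set (L @ N # R)) = N"
    by (rule Max_eqI) (use assms in \<open>auto intro: less_imp_le\<close>)
  have T: "takeWhile (\<lambda>y. y \<noteq> N) (L @ N # R) = L"
    using assms by (subst takeWhile_append2) auto
  have D: "dropWhile (\<lambda>y. y \<noteq> N) (L @ N # R) = N # R"
    using assms by (subst dropWhile_append2) auto
  obtain x xs where w: "L @ N # R = x # xs" by (cases "L @ N # R") auto
  have "stack_sort (x # xs) = stack_sort L @ stack_sort R @ [N]"
    using M T D unfolding w by (simp only: stack_sort.simps Let_def list.sel)
  then show ?thesis by (simp only: w)
qed

definition uniquely_sorted :: "nat \<Rightarrow> nat list \<Rightarrow> bool" where
  "uniquely_sorted n \<pi> \<longleftrightarrow>
     \<pi> \<in> permutations_of_set {1..n} \<and>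
     (\<exists>!\<sigma>. \<sigma> \<in> permutations_of_set {1..n} \<and> stack_sort \<sigma> = \<pi>)"

text \<open>
  The number \<open>A\<^sub>k\<^sub>+\<^sub>1(l)\<close> is \<open>uniquely_sorted_count (2 * k + 1) l\<close>; indexing by the length
  avoids truncated subtraction.
\<close>
definition uniquely_sorted_count :: "nat \<Rightarrow> nat \<Rightarrow> nat" where
  "uniquely_sorted_count n l = card {\<pi>. uniquely_sorted n \<pi> \<and> hd \<pi> = l}"

definition unimodal :: "(nat \<Rightarrow> nat) \<Rightarrow> nat \<Rightarrow> bool" where
  "unimodal a n \<longleftrightarrow>
     (\<exists>p\<in>{1..n}. (\<forall>i\<in>{1..<p}. a i \<le> a (i + 1)) \<and> (\<forall>i\<in>{p..<n}. a i \<ge> a (i + 1)))"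

end

theory Submission
  imports Defs "HOL-Computational_Algebra.Polynomial"
begin

text \<open>
  The map \<open>stack_sort\<close> turns the in-order reading of a decreasing binary tree into its
  postorder reading. If a permutation has a unique preimage, the tree is full (a single child
  could be moved to the other side) and each left child is larger than the first leaf of its
  right sibling's subtree (otherwise the left subtree could be hung below that leaf). Conversely,
  for such a tree the descents of the postorder reading mark its leaves, which determines the
  tree.

  Splitting at the root gives a recursion for the number of these trees, which is solved by
  \<open>A\<^sub>k\<^sub>+\<^sub>1(l) = E (P\<^sub>i P\<^sub>j)\<close> with \<open>i = l - 1\<close> and \<open>j = 2 * k + 1 - l\<close>. Here
  \<open>P\<^sub>0 = 1\<close> and \<open>P\<^sub>n\<^sub>+\<^sub>1 = X P\<^sub>n - (\<Sum>s<n. P\<^sub>s P\<^sub>n\<^sub>-\<^sub>1\<^sub>-\<^sub>s)\<close> is an Appell sequence and \<open>E\<close> is the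
  linear functional with \<open>E P\<^sub>n = 0\<close> for \<open>n > 0\<close> and \<open>E P\<^sub>0 = 1\<close>. (In terms of generating
  functions, \<open>c(x) c(y) / c(x + y)\<close> with \<open>c(z) = J\<^sub>1(2z) / z\<close>.)

  The recursion of \<open>P\<close> expresses \<open>P\<^sub>i\<^sub>+\<^sub>1 P\<^sub>j - P\<^sub>i P\<^sub>j\<^sub>+\<^sub>1\<close> by products of total degree smaller
  by two. Hence, by induction on the degree, \<open>E\<close> is nonnegative on products of any number of the
  \<open>P\<^sub>i\<close>, and its value increases when two indices with fixed sum are brought closer together.
\<close>

section \<open>An Appell sequence and its umbral functional\<close>

fun appell :: "nat \<Rightarrow> int poly" where
  "appell 0 = 1"
| "appell (Suc n) = [:0, 1:] * appell n - (\<Sum>s<n. appell s * appell (n - 1 - s))"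

declare appell.simps(2) [simp del]

lemma degree_appell_le: "degree (appell n) \<le> n"
proof (induction n rule: less_induct)
  case (less n)
  show ?case
  proof (cases n)
    case (Suc m)
    have "degree ([:0, 1:] * appell m) \<le> Suc m"
      using less.IH[of m] Suc by (intro order.trans[OF degree_mult_le]) simp
    moreover have "degree (\<Sum>s<m. appell s * appell (m - 1 - s)) \<le> Suc m"
    proof (intro degree_sum_le)
      fix s assume "s \<in> {..<m}"
      then have "degree (appell s) + degree (appell (m - 1 - s)) \<le> s + (m - 1 - s)"
        using less.IH Suc by (intro add_mono) auto
      also have "\<dots> \<le> Suc m" using \<open>s \<in> {..<m}\<close> by simp
      finally show "degree (appell s * appell (m - 1 - s)) \<le> Suc m"
        by (rule order.trans[OF degree_mult_le])
    qed simp
    ultimately show ?thesis using Suc by (simp only: appell.simps degree_diff_le)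
  qed simp
qed

lemma coeff_appell_self: "coeff (appell n) n = 1"
proof (induction n)
  case (Suc n)
  have "coeff (appell s * appell (n - 1 - s)) (Suc n) = 0" if "s < n" for s
  proof (rule coeff_eq_0)
    have "degree (appell s * appell (n - 1 - s)) \<le> s + (n - 1 - s)"
      by (intro order.trans[OF degree_mult_le] add_mono degree_appell_le)
    then show "degree (appell s * appell (n - 1 - s)) < Suc n" using that by simp
  qed
  then show ?case using Suc by (simp add: appell.simps coeff_sum)
qed simp

text \<open>As \<open>appell n\<close> is monic of degree \<open>n\<close>, requiring the functional
  to vanish on it for \<open>n > 0\<close> determines the \<open>n\<close>-th moment from the
  earlier ones.\<close>

fun moment :: "nat \<Rightarrow> int" where
  "moment n = (if n = 0 then 1 else - (\<Sum>k<n. coeff (appell n) k * moment k))"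

declare moment.simps [simp del]

definition umbral :: "int poly \<Rightarrow> int" where
  "umbral f = (\<Sum>k\<le>degree f. coeff f k * moment k)"

lemma umbral_eq_sum:
  assumes "degree f \<le> N"
  shows "umbral f = (\<Sum>k\<le>N. coeff f k * moment k)"
  unfolding umbral_def
  by (rule sum.mono_neutral_left) (use assms in \<open>auto simp: coeff_eq_0\<close>)

lemma umbral_add: "umbral (f + g) = umbral f + umbral g"
proof -
  let ?N = "max (degree f) (degree g)"
  have "umbral (f + g) = (\<Sum>k\<le>?N. coeff (f + g) k * moment k)"
    by (intro umbral_eq_sum degree_add_le) auto
  also have "\<dots> = umbral f + umbral g"
    by (simp add: umbral_eq_sum[of f ?N] umbral_eq_sum[of g ?N] sum.distrib algebra_simps)
  finally show ?thesis .
qed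

lemma umbral_smult: "umbral (smult c f) = c * umbral f"
  using umbral_eq_sum[OF degree_smult_le, of c f]
  by (simp add: umbral_def sum_distrib_left mult.assoc)

lemma umbral_diff: "umbral (f - g) = umbral f - umbral g"
  using umbral_add[of f "smult (- 1) g"] umbral_smult[of "- 1" g] by simp

lemma umbral_0 [simp]: "umbral 0 = 0"
  by (simp add: umbral_def)

lemma umbral_sum: "umbral (sum f A) = (\<Sum>x\<in>A. umbral (f x))"
  by (induction A rule: infinite_finite_induct) (auto simp: umbral_add)

lemma umbral_appell: "umbral (appell n) = of_bool (n = 0)"
proof (cases "n = 0")
  case False
  have "umbral (appell n) = (\<Sum>k\<le>n. coeff (appell n) k * moment k)"
    by (rule umbral_eq_sum[OF degree_appell_le])
  also have "\<dots> = moment n + (\<Sum>k<n. coeff (appell n) k * moment k)"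
    by (simp add: coeff_appell_self lessThan_Suc_atMost [symmetric])
  also have "\<dots> = 0" using False by (subst moment.simps) simp
  finally show ?thesis using False by simp
qed (simp add: umbral_def moment.simps)

lemma umbral_X_appell:
  "umbral ([:0, 1:] * appell m) = (\<Sum>s<m. umbral (appell s * appell (m - 1 - s)))"
  using umbral_appell[of "Suc m"] by (simp add: appell.simps umbral_diff umbral_sum)

text \<open>Averaging with the reflection of \<open>s\<close> to \<open>n - s\<close> makes the
  weight constant.\<close>

lemma sum_weighted_convolution:
  fixes f :: "nat \<Rightarrow> 'a::comm_ring_1"
  shows "2 * (\<Sum>s\<le>n. of_nat (Suc s) * (f s * f (n - s))) =
    of_nat (n + 2) * (\<Sum>s\<le>n. f s * f (n - s))"
proof -
  have "(\<Sum>s\<le>n. of_nat (Suc s) * (f s * f (n - s))) =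
      (\<Sum>s\<le>n. of_nat (Suc (n - s)) * (f (n - s) * f s))"
    by (rule sum.reindex_bij_witness[of _ "\<lambda>s. n - s" "\<lambda>s. n - s"]) auto
  then have "2 * (\<Sum>s\<le>n. of_nat (Suc s) * (f s * f (n - s))) =
      (\<Sum>s\<le>n. of_nat (Suc s) * (f s * f (n - s)) + of_nat (Suc (n - s)) * (f (n - s) * f s))"
    by (simp add: sum.distrib)
  also have "\<dots> = (\<Sum>s\<le>n. of_nat (n + 2) * (f s * f (n - s)))"
  proof (rule sum.cong)
    fix s assume "s \<in> {..n}"
    then have "(of_nat (n + 2) :: 'a) = of_nat (Suc s) + of_nat (Suc (n - s))"
      by (simp flip: of_nat_add)
    then show "of_nat (Suc s) * (f s * f (n - s)) + of_nat (Suc (n - s)) * (f (n - s) * f s) =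
        of_nat (n + 2) * (f s * f (n - s))"
      by (simp only: algebra_simps)
  qed simp
  finally show ?thesis by (simp add: sum_distrib_left)
qed

text \<open>This is the Appell property. By induction, differentiating the convolution in the
  recursion gives a weighted convolution of lower degree, which an earlier instance of the recursion
  evaluates.\<close>

lemma pderiv_appell: "pderiv (appell n) = of_nat n * appell (n - 1)"
proof (induction n rule: less_induct)
  case (less n)
  consider "n = 0" | "n = 1" | m where "n = Suc (Suc m)"
    by (metis One_nat_def not0_implies_Suc)
  then show ?case
  proof cases
    case 3
    have X: "pderiv [:0, 1 :: int:] = 1" by (simp add: pderiv_pCons)
    let ?C = "\<lambda>n. \<Sum>s\<le>n. appell s * appell (n - s)"
    have conv: "appell (Suc (Suc l)) = [:0, 1:] * appell (Suc l) - ?C l" for l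
      by (simp only: appell.simps(2)[of "Suc l"] lessThan_Suc_atMost diff_Suc_1)
    have "pderiv (?C m) = (\<Sum>s\<le>m. pderiv (appell s) * appell (m - s)) +
        (\<Sum>s\<le>m. pderiv (appell (m - s)) * appell s)"
      by (simp add: higher_pderiv_sum[of 1, simplified] pderiv_mult sum.distrib algebra_simps)
    also have "(\<Sum>s\<le>m. pderiv (appell (m - s)) * appell s) =
        (\<Sum>s\<le>m. pderiv (appell s) * appell (m - s))"
      by (rule sum.reindex_bij_witness[of _ "\<lambda>s. m - s" "\<lambda>s. m - s"]) auto
    also have "(\<Sum>s\<le>m. pderiv (appell s) * appell (m - s)) =
        (\<Sum>s\<le>m. of_nat s * appell (s - 1) * appell (m - s))"
      using less.IH 3 by (intro sum.cong) auto
    finally have dC: "pderiv (?C m) = 2 * (\<Sum>s\<le>m. of_nat s * appell (s - 1) * appell (m - s))"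
      by simp
    \<comment> \<open>Symmetrisation yields a multiple of \<open>?C (m - 1)\<close>, and
      \<open>conv\<close> solves the recursion for that sum; for \<open>m = 0\<close> both sides
      vanish.\<close>
    have "pderiv (?C m) = of_nat (Suc m) * ([:0, 1:] * appell m - appell (Suc m))"
    proof (cases m)
      case 0
      then show ?thesis by (simp add: dC appell.simps)
    next
      case (Suc l)
      have "pderiv (?C m) = 2 * (\<Sum>s\<le>l. of_nat (Suc s) * (appell s * appell (l - s)))"
        unfolding dC unfolding Suc by (subst sum.atMost_Suc_shift) (simp add: mult.assoc)
      also have "\<dots> = of_nat (l + 2) * ?C l"
        by (rule sum_weighted_convolution)
      also have "?C l = [:0, 1:] * appell m - appell (Suc m)"
        unfolding Suc conv by simp
      finally show ?thesis using Suc by simp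
    qed
    moreover have "pderiv (appell (Suc m)) = of_nat (Suc m) * appell m"
      using less.IH[of "Suc m"] 3 by simp
    ultimately show ?thesis
      unfolding 3 conv by (simp only: pderiv_diff pderiv_mult X) (simp add: algebra_simps)
  qed (simp_all add: appell.simps pderiv_pCons)
qed

text \<open>By induction on \<open>i + j\<close> both sides have the same derivative, so they differ
  by a constant. The functional agrees on both sides and fixes constants, so this constant is
  0.\<close>

theorem appell_mult:
  "appell i * appell j = (\<Sum>p\<le>i. \<Sum>q\<le>j.
     smult (of_nat ((i choose p) * (j choose q)) * umbral (appell p * appell q))
       (appell (i - p + (j - q))))"
proof (induction "i + j" arbitrary: i j rule: less_induct)
  case less
  define rhs where "rhs = (\<lambda>i j. \<Sum>p\<le>i. \<Sum>q\<le>j.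
     smult (of_nat ((i choose p) * (j choose q)) * umbral (appell p * appell q))
       (appell (i - p + (j - q))))"
  define u where "u = (\<lambda>p q. umbral (appell p * appell q))"
  have IH: "rhs i' j' = appell i' * appell j'" if "i' + j' < i + j" for i' j'
    using less[OF that] by (simp add: rhs_def)
  \<comment> \<open>Absorption moves the factor from differentiation onto the binomial. The extra
    terms \<open>p = i\<close> in \<open>left\<close> and \<open>q = j\<close> in
    \<open>right\<close> carry the factor 0.\<close>
  have absorb: "(n - p) * (n choose p) = n * ((n - 1) choose p)" for n p :: nat
    by (rule binomial_absorb_comp)
  have left: "of_nat i * rhs (i - 1) j = (\<Sum>p\<le>i. \<Sum>q\<le>j.
     smult (of_nat ((i - p) * (i choose p) * (j choose q)) * u p q)
       (appell (i - p + (j - q) - 1)))"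
  proof (cases i)
    case (Suc n)
    have "(\<Sum>q\<le>j. smult (of_nat ((i - p) * (i choose p) * (j choose q)) * u p q)
       (appell (i - p + (j - q) - 1))) =
      of_nat i * (\<Sum>q\<le>j. smult (of_nat ((n choose p) * (j choose q)) * u p q)
       (appell (n - p + (j - q))))" if "p \<le> n" for p
      unfolding absorb using that Suc
      by (simp add: sum_distrib_left Suc_diff_le mult_ac of_nat_mult_conv_smult del: of_nat_Suc mult_Suc)
    then show ?thesis
      using Suc by (simp add: rhs_def u_def sum_distrib_left del: of_nat_Suc mult_Suc)
  qed simp
  have right: "of_nat j * rhs i (j - 1) = (\<Sum>p\<le>i. \<Sum>q\<le>j.
     smult (of_nat ((i choose p) * ((j - q) * (j choose q))) * u p q)
       (appell (i - p + (j - q) - 1)))"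
  proof (cases j)
    case (Suc n)
    have *: "(\<Sum>q\<le>j. smult (of_nat ((i choose p) * ((j - q) * (j choose q))) * u p q)
       (appell (i - p + (j - q) - 1))) =
      of_nat j * (\<Sum>q\<le>n. smult (of_nat ((i choose p) * (n choose q)) * u p q)
       (appell (i - p + (n - q))))" for p
      unfolding absorb using Suc
      by (simp add: sum_distrib_left Suc_diff_le mult_ac of_nat_mult_conv_smult del: of_nat_Suc mult_Suc)
    show ?thesis
      unfolding * by (simp add: Suc rhs_def u_def sum_distrib_left del: of_nat_Suc mult_Suc)
  qed simp
  have "pderiv (rhs i j) = (\<Sum>p\<le>i. \<Sum>q\<le>j.
     smult (of_nat ((i choose p) * (j choose q)) * u p q)
       (of_nat (i - p + (j - q)) * appell (i - p + (j - q) - 1)))"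
    unfolding rhs_def u_def by (simp add: higher_pderiv_sum[of 1, simplified] pderiv_smult pderiv_appell)
  also have "\<dots> = of_nat i * rhs (i - 1) j + of_nat j * rhs i (j - 1)"
    unfolding left right sum.distrib [symmetric]
    by (intro sum.cong refl, simp only: of_nat_mult_conv_smult smult_smult smult_add_left [symmetric])
      (rule arg_cong2[where f = smult], simp_all add: algebra_simps)
  also have "of_nat i * rhs (i - 1) j = of_nat i * (appell (i - 1) * appell j)"
    using IH[of "i - 1" j] by (cases "i = 0") simp_all
  also have "of_nat j * rhs i (j - 1) = of_nat j * (appell i * appell (j - 1))"
    using IH[of i "j - 1"] by (cases "j = 0") simp_all
  also have "of_nat i * (appell (i - 1) * appell j) + of_nat j * (appell i * appell (j - 1)) =
      pderiv (appell i * appell j)"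
    by (simp add: pderiv_mult pderiv_appell algebra_simps)
  finally have "pderiv (appell i * appell j - rhs i j) = 0" by (simp add: pderiv_diff)
  then obtain c where c: "appell i * appell j - rhs i j = [:c:]"
    by (metis degree_eq_zeroE pderiv_eq_0_iff)
  \<comment> \<open>Only the term \<open>p = i\<close>, \<open>q = j\<close> contains
    \<open>appell 0\<close>, so it alone survives.\<close>
  have "umbral (rhs i j) = (\<Sum>p\<le>i. \<Sum>q\<le>j.
      of_nat ((i choose p) * (j choose q)) * u p q * of_bool (p = i \<and> q = j))"
    unfolding rhs_def u_def umbral_sum umbral_smult umbral_appell
    by (intro sum.cong refl) (auto simp: of_bool_def)
  also have "\<dots> = (\<Sum>p\<le>i. if p = i then (\<Sum>q\<le>j. if q = j then u i j else 0) else 0)"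
    by (intro sum.cong refl) (auto intro!: sum.cong)
  also have "\<dots> = u i j" by (simp add: sum.delta)
  finally have "umbral [:c:] = 0"
    unfolding c [symmetric] umbral_diff u_def by simp
  then have "c = 0" by (simp add: umbral_def moment.simps)
  then show ?case using c by (simp add: rhs_def)
qed

text \<open>This and the next identity have the shape of sums over the label set of a left subtree:
  \<open>p\<close> and \<open>q\<close> count its letters below and above its first letter. Here
  \<open>s\<close> is the rank of the first letter of the right subtree.\<close>

lemma umbral_X_appell_mult:
  "umbral ([:0, 1:] * (appell i * appell j)) = (\<Sum>p\<le>i. \<Sum>q\<le>j.
     of_nat ((i choose p) * (j choose q)) * umbral (appell p * appell q) *
     (\<Sum>s<i - p + (j - q). umbral (appell s * appell (i - p + (j - q) - 1 - s))))"
  by (subst appell_mult)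
    (simp add: sum_distrib_left umbral_sum umbral_smult umbral_X_appell mult.assoc
      del: mult_pCons_left)

lemma umbral_appell_mult3:
  "umbral (appell i * appell j * appell l) = (\<Sum>p\<le>i. \<Sum>q\<le>j.
     of_nat ((i choose p) * (j choose q)) * umbral (appell p * appell q) *
     umbral (appell (i - p + (j - q)) * appell l))"
  by (subst appell_mult) (simp add: sum_distrib_right umbral_sum umbral_smult)

section \<open>Positivity and balancing of the functional on products\<close>

definition appell_joint :: "nat list \<Rightarrow> int" where
  "appell_joint rs = umbral (prod_list (map appell rs))"

lemma appell_joint_swap: "appell_joint (p # q # rs) = appell_joint (q # p # rs)"
  by (simp add: appell_joint_def mult.left_commute)

text \<open>The terms \<open>[:0, 1:] * appell i * appell j\<close> cancel, and the remaining index
  sums are smaller by two. Arbitrarily many factors \<open>rs\<close> are carried along because the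
  recursion splits one factor into two.\<close>

lemma appell_joint_step:
  "appell_joint (Suc i # j # rs) - appell_joint (i # Suc j # rs) =
     (\<Sum>s<j. appell_joint (s # i # (j - 1 - s) # rs)) -
     (\<Sum>s<i. appell_joint (s # (i - 1 - s) # j # rs))"
proof -
  have "appell (Suc i) * appell j - appell i * appell (Suc j) =
      (\<Sum>s<j. appell s * (appell i * appell (j - 1 - s))) -
      (\<Sum>s<i. appell s * (appell (i - 1 - s) * appell j))"
    by (simp add: appell.simps sum_distrib_left sum_distrib_right algebra_simps)
  then have "(appell (Suc i) * appell j - appell i * appell (Suc j)) * prod_list (map appell rs) =
      (\<Sum>s<j. prod_list (map appell (s # i # (j - 1 - s) # rs))) -
      (\<Sum>s<i. prod_list (map appell (s # (i - 1 - s) # j # rs)))"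
    by (simp only: left_diff_distrib sum_distrib_right list.map prod_list.Cons mult.assoc)
  then have "umbral ((appell (Suc i) * appell j - appell i * appell (Suc j)) *
      prod_list (map appell rs)) =
      (\<Sum>s<j. appell_joint (s # i # (j - 1 - s) # rs)) -
      (\<Sum>s<i. appell_joint (s # (i - 1 - s) # j # rs))"
    by (simp only: appell_joint_def umbral_diff umbral_sum)
  then show ?thesis
    by (simp only: appell_joint_def left_diff_distrib umbral_diff list.map prod_list.Cons mult.assoc)
qed

text \<open>The smaller index is raised by ones from \<open>a\<close> to \<open>min a' b'\<close>;
  symmetry covers the order of the target pair. The step is assumed for the fixed total
  \<open>n\<close> only, so that an induction hypothesis can supply it.\<close>

lemma appell_joint_balance:
  assumes step: "\<And>i j. i < j \<Longrightarrow> i + Suc j = n \<Longrightarrow>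
      appell_joint (i # Suc j # rs) \<le> appell_joint (Suc i # j # rs)"
    and "a + b = n" "a' + b' = n" "a \<le> a'" "a \<le> b'"
  shows "appell_joint (a # b # rs) \<le> appell_joint (a' # b' # rs)"
proof -
  have mono: "appell_joint (a # (n - a) # rs) \<le> appell_joint (c # (n - c) # rs)"
    if "a \<le> c" "2 * c \<le> n" for c
    using that
  proof (induction c rule: dec_induct)
    case (step c)
    then have "n - c = Suc (n - Suc c)" by simp
    then show ?case using step assms(1)[of c "n - Suc c"] by simp
  qed simp
  have "appell_joint (a # (n - a) # rs) \<le> appell_joint (min a' b' # (n - min a' b') # rs)"
    using assms by (intro mono) auto
  moreover have "n - a = b" "n - a' = b'" "n - b' = a'" using assms by auto
  ultimately show ?thesis
    by (auto simp: min_def appell_joint_swap[of b'] split: if_splits)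
qed

text \<open>The claims are intertwined: balancing at \<open>N\<close> uses both claims at smaller
  totals, and nonnegativity at \<open>N\<close> uses balancing at \<open>N\<close>.\<close>

lemma appell_joint_unimodal_nonneg:
  "(\<forall>i j rs. i < j \<longrightarrow> i + Suc j + sum_list rs = N \<longrightarrow>
      appell_joint (i # Suc j # rs) \<le> appell_joint (Suc i # j # rs)) \<and>
   (\<forall>rs. sum_list rs = N \<longrightarrow> 0 \<le> appell_joint rs)"
proof (induction N rule: less_induct)
  case (less N)
  have step: "appell_joint (i # Suc j # rs) \<le> appell_joint (Suc i # j # rs)"
    if "i < j" "i + Suc j + sum_list rs = N" for i j rs
  proof -
    have "(\<Sum>s<i. appell_joint (s # (i - 1 - s) # j # rs)) \<le>
        (\<Sum>s<i. appell_joint (s # i # (j - 1 - s) # rs))"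
    proof (rule sum_mono)
      fix s assume s: "s \<in> {..<i}"
      \<comment> \<open>With \<open>s\<close> as a spectator, the pairs
        \<open>(i - 1 - s, j)\<close> and \<open>(i, j - 1 - s)\<close> have equal sums, and the
        second is more balanced since \<open>i < j\<close>.\<close>
      have "appell_joint ((i - 1 - s) # j # (s # rs)) \<le>
          appell_joint (i # (j - 1 - s) # (s # rs))"
      proof (rule appell_joint_balance[where n = "i - 1 - s + j"])
        fix i' j' assume "i' < j'" "i' + Suc j' = i - 1 - s + j"
        then show "appell_joint (i' # Suc j' # (s # rs)) \<le> appell_joint (Suc i' # j' # (s # rs))"
          using s that less.IH[of "i' + Suc j' + sum_list (s # rs)"] by auto
      qed (use s that in auto)
      then show "appell_joint (s # (i - 1 - s) # j # rs) \<le>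
          appell_joint (s # i # (j - 1 - s) # rs)"
        by (simp add: appell_joint_def mult_ac)
    qed
    also have "\<dots> \<le> (\<Sum>s<j. appell_joint (s # i # (j - 1 - s) # rs))"
    proof (rule sum_mono2)
      fix s assume "s \<in> {..<j} - {..<i}"
      then show "0 \<le> appell_joint (s # i # (j - 1 - s) # rs)"
        using that less.IH[of "sum_list (s # i # (j - 1 - s) # rs)"] by auto
    qed (use that in auto)
    finally show ?thesis using appell_joint_step[of i j rs] by linarith
  qed
  have "0 \<le> appell_joint rs" if "sum_list rs = N" for rs
    using that
  proof (induction rs rule: length_induct)
    case (1 rs)
    consider "rs = []" | r where "rs = [r]" | p q rs' where "rs = p # q # rs'"
      by (metis neq_Nil_conv)
    then show ?case
    proof cases
      case (3 p q rs')
      \<comment> \<open>The merged list is shorter. Inserting an index 0 is free as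
        \<open>appell 0 = 1\<close>, and balancing \<open>(0, p + q)\<close> to
        \<open>(p, q)\<close> does not decrease the value.\<close>
      have "0 \<le> appell_joint ((p + q) # rs')" using 1 3 by simp
      also have "\<dots> = appell_joint (0 # (p + q) # rs')" by (simp add: appell_joint_def)
      also have "\<dots> \<le> appell_joint (p # q # rs')"
      proof (rule appell_joint_balance[where n = "p + q"])
        fix i j assume "i < j" "i + Suc j = p + q"
        then show "appell_joint (i # Suc j # rs') \<le> appell_joint (Suc i # j # rs')"
          using 1(2) 3 by (intro step) auto
      qed auto
      finally show ?thesis using 3 by simp
    qed (simp_all add: appell_joint_def umbral_appell umbral_appell[of 0, simplified])
  qed
  then show ?case using step by blast
qed

lemma umbral_appell_mult_mono:
  "i < j \<Longrightarrow> umbral (appell i * appell (Suc j)) \<le> umbral (appell (Suc i) * appell j)"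
  using conjunct1[OF appell_joint_unimodal_nonneg, rule_format, of i j "[]"]
  by (simp add: appell_joint_def)

section \<open>Postorder readings of full binary trees\<close>

fun descents :: "'a::linorder list \<Rightarrow> nat" where
  "descents (x # y # xs) = of_bool (y < x) + descents (y # xs)"
| "descents _ = 0"

lemma descents_append:
  assumes "xs \<noteq> []" "ys \<noteq> []"
  shows "descents (xs @ ys) = descents xs + descents ys + of_bool (hd ys < last xs)"
  using assms(1)
proof (induction xs rule: descents.induct)
  case ("2_2" x)
  then show ?case using assms(2) by (cases ys) auto
qed auto

lemma descents_snoc:
  assumes "\<forall>y\<in>set xs. y < N"
  shows "descents (xs @ [N]) = descents xs"
  using assms descents_append[of xs "[N]"] by (cases "xs = []") (auto dest: order.asym last_in_set)

text \<open>Here \<open>last L\<close> is the root of the left subtree and \<open>hd R\<close> the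
  first leaf of the right one. Only children have no rule, so the trees are full.\<close>

inductive binary_postorder :: "nat list \<Rightarrow> bool" where
  leaf: "binary_postorder [a]"
| node: "binary_postorder L \<Longrightarrow> binary_postorder R \<Longrightarrow> distinct (L @ R) \<Longrightarrow>
    \<forall>y\<in>set L \<union> set R. y < N \<Longrightarrow> hd R < last L \<Longrightarrow>
    binary_postorder (L @ R @ [N])"

lemma binary_postorder_nonempty: "binary_postorder w \<Longrightarrow> w \<noteq> []"
  by (induction rule: binary_postorder.induct) auto

lemma binary_postorder_distinct: "binary_postorder w \<Longrightarrow> distinct w"
  by (induction rule: binary_postorder.induct) auto

lemma Max_binary_postorder: "binary_postorder w \<Longrightarrow> Max (set w) = last w"
proof (induction rule: binary_postorder.induct)
  case (node L R N)
  then show ?case by (intro Max_eqI) (auto intro: less_imp_le)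
qed auto

lemma descents_node:
  assumes "L \<noteq> []" "R \<noteq> []" "\<forall>y\<in>set L \<union> set R. y < N"
  shows "descents (L @ R @ [N]) = descents L + descents R + of_bool (hd R < last L)"
  using assms descents_snoc[of "L @ R" N] by (auto simp: descents_append)

text \<open>Each inner node contributes exactly one descent, at the junction of its subtrees, and a
  full tree with \<open>d\<close> inner nodes has \<open>d + 1\<close> leaves.\<close>

lemma length_binary_postorder: "binary_postorder w \<Longrightarrow> length w = 2 * descents w + 1"
proof (induction rule: binary_postorder.induct)
  case (node L R N)
  then show ?case by (simp add: descents_node binary_postorder_nonempty)
qed simp

text \<open>
  For a prefix \<open>p\<close>, the number \<open>2 * descents p + 2 - length p\<close> counts the trees of the
  forest of which \<open>p\<close> is the postorder reading.
\<close>
lemma length_prefix_binary_postorder: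
  assumes "binary_postorder w" "w = p @ q" "p \<noteq> []"
  shows "length p \<le> 2 * descents p + 1"
  using assms
proof (induction arbitrary: p q rule: binary_postorder.induct)
  case (leaf a)
  then show ?case by (cases p) auto
next
  case (node L R N)
  have L: "L \<noteq> []" "length L = 2 * descents L + 1"
    using node.hyps by (auto simp: binary_postorder_nonempty length_binary_postorder)
  from \<open>L @ R @ [N] = p @ q\<close> obtain us where
    "L = p @ us \<or> L @ us = p \<and> R @ [N] = us @ q"
    by (auto simp: append_eq_append_conv2)
  then consider "L = p @ us" | "p = L" | "us \<noteq> []" "p = L @ us" "R @ [N] = us @ q"
    by fastforce
  then show ?case
  proof cases
    case 1
    then show ?thesis using node.IH(1) node.prems by blast
  next
    case 2
    then show ?thesis using L by simp
  next
    case 3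
    show ?thesis
    proof (cases "q = []")
      case True
      have "binary_postorder (L @ R @ [N])" using node by (intro binary_postorder.node)
      from length_binary_postorder[OF this] show ?thesis using True 3 by simp
    next
      case False
      then have "q = butlast q @ [N]" using 3 by (metis append_butlast_last_id last_appendR last_snoc)
      then have R: "R = us @ butlast q" using 3 by (metis append.assoc append_same_eq)
      \<comment> \<open>This makes the junction of \<open>L\<close> and \<open>us\<close> a descent,
        which absorbs the additional 1 from adding the two length bounds.\<close>
      then have "hd us = hd R" using 3 by simp
      moreover have "length us \<le> 2 * descents us + 1" using node.IH(2)[OF R] 3 by blast
      ultimately show ?thesis using L 3 node.hyps by (simp add: descents_append)
    qed
  qed
qed

text \<open>Otherwise \<open>L @ us\<close>, with \<open>us\<close> a nonempty prefix of
  \<open>R\<close>, would be the reading of one tree. But the descent at the junction makes it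
  shorter than a tree with that many descents.\<close>

lemma binary_postorder_split_unique:
  assumes "binary_postorder L" "binary_postorder R" "hd R < last L"
    and "binary_postorder L'" "binary_postorder R'" "hd R' < last L'"
    and "L @ R = L' @ R'"
  shows "L = L' \<and> R = R'"
proof -
  have no_overlap: False
    if *: "binary_postorder L" "binary_postorder R" "hd R < last L"
      "binary_postorder (L @ us)" "R = us @ R'" "us \<noteq> []" for L R R' us
  proof -
    have "length us \<le> 2 * descents us + 1"
      using length_prefix_binary_postorder * by blast
    moreover have "hd us < last L" using * by simp
    ultimately show False
      using *(4,6) length_binary_postorder[OF *(1)] length_binary_postorder[OF *(4)]
      by (simp add: descents_append binary_postorder_nonempty[OF *(1)])
  qed
  from assms(7) obtain us where us: "L = L' @ us \<and> us @ R = R' \<or> L @ us = L' \<and> R = us @ R'"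
    by (auto simp: append_eq_append_conv2)
  moreover have "us = []"
    using us no_overlap[of L R us R'] no_overlap[of L' R' us R] assms by metis
  ultimately show ?thesis by simp
qed

section \<open>Stack-sorting on decreasing binary trees\<close>

text \<open>Induction over the decreasing binary tree of a word, parallel to the recursion of
  \<open>stack_sort\<close>.\<close>

lemma distinct_max_induct [consumes 1, case_names Nil split]:
  fixes w :: "'a::linorder list"
  assumes "distinct w" "P []"
    and split: "\<And>L N R. P L \<Longrightarrow> P R \<Longrightarrow> distinct (L @ N # R) \<Longrightarrow>
      \<forall>y\<in>set L \<union> set R. y < N \<Longrightarrow> P (L @ N # R)"
  shows "P w"
  using assms(1)
proof (induction w rule: length_induct)
  case (1 w)
  show ?case
  proof (cases "w = []")
    case False
    then have "Max (set w) \<in> set w" by simp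
    then obtain L R where w: "w = L @ Max (set w) # R" by (meson split_list)
    have lt: "\<forall>y\<in>set L \<union> set R. y < Max (set w)"
    proof
      fix y assume that: "y \<in> set L \<union> set R"
      have "y \<in> set w" using that by (subst w) auto
      moreover have "distinct (L @ Max (set w) # R)" using 1(2) w by metis
      ultimately show "y < Max (set w)" using that by (auto simp: less_le)
    qed
    have len: "length L < length w" "length R < length w"
      using arg_cong[OF w, of length] by auto
    have d: "distinct (L @ Max (set w) # R)" using 1(2) w by metis
    then have "P L" "P R" using 1(1) len by auto
    then have "P (L @ Max (set w) # R)" using lt d by (intro split)
    then show ?thesis using w by metis
  qed (use assms(2) in simp)
qed

lemma distinct_max_split:
  fixes w :: "'a::linorder list"
  assumes "distinct w" "w \<noteq> []"
  obtains L N R where "w = L @ N # R" "\<forall>y\<in>set L \<union> set R. y < N"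
proof -
  have "w \<noteq> [] \<longrightarrow> (\<exists>L N R. w = L @ N # R \<and> (\<forall>y \<in> set L \<union> set R. y < N))"
    using assms(1)
  proof (induction w rule: distinct_max_induct)
    case (split L N R)
    then show ?case by blast
  qed simp
  then show ?thesis using assms(2) that by blast
qed

lemma stack_sort_max_split:
  "\<forall>y\<in>set L \<union> set R. y < N \<Longrightarrow>
    stack_sort (L @ N # R) = stack_sort L @ stack_sort R @ [N]"
  by (rule stack_sort_split) blast

lemma mset_stack_sort: "distinct w \<Longrightarrow> mset (stack_sort w) = mset w"
  by (induction w rule: distinct_max_induct) (auto simp: stack_sort_max_split)

lemma set_stack_sort: "distinct w \<Longrightarrow> set (stack_sort w) = set w"
  by (metis mset_stack_sort set_mset_mset)

lemma length_stack_sort: "distinct w \<Longrightarrow> length (stack_sort w) = length w"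
  by (metis mset_stack_sort size_mset)

lemma distinct_stack_sort: "distinct w \<Longrightarrow> distinct (stack_sort w)"
  by (metis mset_stack_sort mset_eq_imp_distinct_iff)

lemma stack_sort_eq_Nil_iff: "distinct w \<Longrightarrow> stack_sort w = [] \<longleftrightarrow> w = []"
  by (metis length_stack_sort length_0_conv)

text \<open>If \<open>L\<close> is empty, the word starts with its maximum; otherwise both first
  letters come from \<open>L\<close>.\<close>

lemma hd_stack_sort_le: "distinct w \<Longrightarrow> w \<noteq> [] \<Longrightarrow> hd (stack_sort w) \<le> hd w"
proof (induction w rule: distinct_max_induct)
  case (split L N R)
  show ?case
  proof (cases "L = []")
    case True
    have "hd (stack_sort (L @ N # R)) \<in> set (L @ N # R)"
      using split by (metis hd_in_set set_stack_sort stack_sort_eq_Nil_iff)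
    then show ?thesis using True split by (auto intro: less_imp_le)
  next
    case False
    then show ?thesis using split by (simp add: stack_sort_max_split stack_sort_eq_Nil_iff)
  qed
qed simp

text \<open>The node \<open>hd R\<close> has no left child in the tree of \<open>R\<close>, so the
  tree of \<open>L\<close> can be hung there; postorder then reads \<open>L\<close> first.\<close>

lemma stack_sort_append:
  assumes "distinct (L @ R)" "R \<noteq> []" "\<And>y. y \<in> set L \<Longrightarrow> y < hd R"
  shows "stack_sort (L @ R) = stack_sort L @ stack_sort R"
proof -
  have "distinct R" using assms by simp
  then show ?thesis using assms
  proof (induction R rule: distinct_max_induct)
    case (split R\<^sub>1 N R\<^sub>2)
    have "y < N" if "y \<in> set L" for y
      using split.prems(3)[OF that] split.hyps by (cases R\<^sub>1) (auto intro: order.strict_trans)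
    then have "stack_sort ((L @ R\<^sub>1) @ N # R\<^sub>2) = stack_sort (L @ R\<^sub>1) @ stack_sort R\<^sub>2 @ [N]"
      using split.hyps by (intro stack_sort_max_split) auto
    moreover have "stack_sort (L @ R\<^sub>1) = stack_sort L @ stack_sort R\<^sub>1"
      using split by (cases "R\<^sub>1 = []") auto
    ultimately show ?case using split.hyps by (simp add: stack_sort_max_split)
  qed simp
qed

text \<open>Descents arise only at the junction of two nonempty subtrees, and fewer than half of the
  nodes of a binary tree have two children.\<close>

lemma descents_stack_sort_le:
  "distinct w \<Longrightarrow> w \<noteq> [] \<Longrightarrow> 2 * descents (stack_sort w) + 1 \<le> length w"
proof (induction w rule: distinct_max_induct)
  case (split L N R)
  have lt: "\<forall>y\<in>set (stack_sort L) \<union> set (stack_sort R). y < N"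
    using split.hyps by (auto simp: set_stack_sort)
  have "descents (stack_sort (L @ N # R)) = descents (stack_sort L @ stack_sort R)"
    using split.hyps lt descents_snoc[of "stack_sort L @ stack_sort R" N]
    by (simp add: stack_sort_max_split)
  moreover have "L = [] \<or> R = [] \<or> descents (stack_sort L @ stack_sort R) \<le>
      descents (stack_sort L) + descents (stack_sort R) + 1"
    using split.hyps
    by (cases "L = [] \<or> R = []") (auto simp: descents_append stack_sort_eq_Nil_iff of_bool_def)
  ultimately show ?case using split
    by (cases "L = []"; cases "R = []") auto
qed simp

text \<open>An only child, slack in a subtree or an ascent at the junction would each make
  \<open>descents_stack_sort_le\<close> strict, so extremality passes down the tree.\<close>

lemma descents_stack_sort_extremal_split:
  assumes "distinct (L @ N # R)" "\<forall>y\<in>set L \<union> set R. y < N"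
    and "length (L @ N # R) = 2 * descents (stack_sort (L @ N # R)) + 1"
  obtains "L = []" "R = []"
  | "L \<noteq> []" "R \<noteq> []" "length L = 2 * descents (stack_sort L) + 1"
    "length R = 2 * descents (stack_sort R) + 1" "hd (stack_sort R) < last (stack_sort L)"
proof -
  have lt: "\<forall>y\<in>set (stack_sort L) \<union> set (stack_sort R). y < N"
    using assms by (auto simp: set_stack_sort)
  have d: "descents (stack_sort (L @ N # R)) = descents (stack_sort L @ stack_sort R)"
    using assms(2) lt descents_snoc[of "stack_sort L @ stack_sort R" N]
    by (simp add: stack_sort_max_split)
  have L: "L \<noteq> [] \<Longrightarrow> 2 * descents (stack_sort L) + 1 \<le> length L"
    and R: "R \<noteq> [] \<Longrightarrow> 2 * descents (stack_sort R) + 1 \<le> length R"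
    using assms(1) descents_stack_sort_le[of L] descents_stack_sort_le[of R] by auto
  consider "L = []" "R = []" | "L = []" "R \<noteq> []" | "L \<noteq> []" "R = []" | "L \<noteq> []" "R \<noteq> []"
    by blast
  then show thesis
  proof cases
    case 4
    then have "descents (stack_sort L @ stack_sort R) =
        descents (stack_sort L) + descents (stack_sort R) +
        of_bool (hd (stack_sort R) < last (stack_sort L))"
      using assms(1) by (simp add: descents_append stack_sort_eq_Nil_iff)
    with d L R 4 assms(3) have
      "length L = 2 * descents (stack_sort L) + 1 \<and> length R = 2 * descents (stack_sort R) + 1 \<and>
       hd (stack_sort R) < last (stack_sort L)"
      by (cases "hd (stack_sort R) < last (stack_sort L)") auto
    then show thesis using 4 that by blast
  qed (use d L R assms(3) that in auto)
qed

lemma binary_postorder_stack_sort: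
  assumes "distinct w" "length w = 2 * descents (stack_sort w) + 1"
  shows "binary_postorder (stack_sort w)"
  using assms
proof (induction w rule: distinct_max_induct)
  case (split L N R)
  from split.hyps split.prems show ?case
  proof (cases rule: descents_stack_sort_extremal_split)
    case 1
    then show ?thesis using split.hyps by (simp add: stack_sort_max_split binary_postorder.leaf)
  next
    case 2
    then have "binary_postorder (stack_sort L @ stack_sort R @ [N])"
      using split by (intro binary_postorder.node)
        (auto simp: set_stack_sort distinct_stack_sort)
    then show ?thesis using split.hyps by (simp add: stack_sort_max_split)
  qed
qed simp

text \<open>Length and descents are read off the common image, so both words are extremal. If they
  are not single letters, unique splitting identifies the images of their subtrees.\<close>

lemma stack_sort_binary_postorder_inj:
  assumes "distinct v" "distinct w" "stack_sort v = stack_sort w"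
    and "binary_postorder (stack_sort v)"
  shows "v = w"
  using assms
proof (induction v arbitrary: w rule: distinct_max_induct)
  case Nil
  then show ?case using stack_sort_eq_Nil_iff[of w] by simp
next
  case (split L N R)
  have "w \<noteq> []" using split.prems split.hyps stack_sort_eq_Nil_iff[of "L @ N # R"] by auto
  then obtain L' N' R' where w: "w = L' @ N' # R'" and lt': "\<forall>y\<in>set L' \<union> set R'. y < N'"
    using distinct_max_split[OF split.prems(1)] by metis
  have eq: "stack_sort L @ stack_sort R = stack_sort L' @ stack_sort R'" "N = N'"
    using split.prems(2) split.hyps(2) lt' by (simp_all add: w stack_sort_max_split)
  have len: "length w = length (L @ N # R)"
    using split.prems split.hyps by (metis length_stack_sort)
  have ext: "length (L @ N # R) = 2 * descents (stack_sort (L @ N # R)) + 1"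
    using length_binary_postorder[OF split.prems(3)] length_stack_sort split.hyps(1) by metis
  then have ext': "length (L' @ N' # R') = 2 * descents (stack_sort (L' @ N' # R')) + 1"
    using len split.prems(2) w by metis
  have d': "distinct (L' @ N' # R')" using split.prems w by simp
  from split.hyps ext show ?case
  proof (cases rule: descents_stack_sort_extremal_split)
    case 1
    then show ?thesis using len w eq by simp
  next
    case L: 2
    from d' lt' ext' show ?thesis
    proof (cases rule: descents_stack_sort_extremal_split)
      case 1
      then show ?thesis using len w L by simp
    next
      case 2
      have "binary_postorder (stack_sort L)" "binary_postorder (stack_sort R)"
        "binary_postorder (stack_sort L')" "binary_postorder (stack_sort R')"
        using L 2 split.hyps(1) d' by (auto intro!: binary_postorder_stack_sort)
      moreover from this have "stack_sort L = stack_sort L' \<and> stack_sort R = stack_sort R'"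
        using L 2 eq by (intro binary_postorder_split_unique)
      ultimately have "L = L'" "R = R'"
        using split.IH d' by auto
      then show ?thesis using w eq by simp
    qed
  qed
qed

lemma ex_stack_sort_eq_binary_postorder:
  "binary_postorder w \<Longrightarrow> \<exists>v. distinct v \<and> set v = set w \<and> stack_sort v = w"
proof (induction rule: binary_postorder.induct)
  case (leaf a)
  then show ?case using stack_sort_max_split[of "[]" "[]" a] by (intro exI[of _ "[a]"]) simp
next
  case (node L R N)
  then obtain L' R' where
    "distinct L'" "set L' = set L" "stack_sort L' = L"
    "distinct R'" "set R' = set R" "stack_sort R' = R"
    by blast
  then show ?case using node.hyps by (intro exI[of _ "L' @ N # R'"]) (auto simp: stack_sort_max_split)
qed

text \<open>Uniqueness passes to both subtrees, since another preimage of one part could be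
  substituted into the whole. The competitors \<open>R @ [N]\<close> and \<open>N # L @ R\<close>
  exclude only children and ascents at the junction.\<close>

lemma binary_postorder_if_unique_preimage:
  assumes "distinct w" "w \<noteq> []"
    and "\<And>v. distinct v \<Longrightarrow> stack_sort v = stack_sort w \<Longrightarrow> v = w"
  shows "binary_postorder (stack_sort w)"
  using assms
proof (induction w rule: distinct_max_induct)
  case Nil
  from Nil.prems(1) show ?case by simp
next
  case (split L N R)
  note lt = split.hyps(2) and d = split.hyps(1)
  have s: "stack_sort (L @ N # R) = stack_sort L @ stack_sort R @ [N]"
    using lt by (rule stack_sort_max_split)
  have same_set: "set v = set w" if "distinct v" "distinct w" "stack_sort v = stack_sort w" for v w
    using that set_stack_sort by metis
  have uniq_L: "v = L" if v: "distinct v" "stack_sort v = stack_sort L" for v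
  proof -
    have "set v = set L" using same_set[OF v(1) _ v(2)] d by simp
    then have "stack_sort (v @ N # R) = stack_sort (L @ N # R)" "distinct (v @ N # R)"
      using v lt d by (auto simp: stack_sort_max_split)
    then show ?thesis using split.prems(2) by blast
  qed
  have uniq_R: "v = R" if v: "distinct v" "stack_sort v = stack_sort R" for v
  proof -
    have "set v = set R" using same_set[OF v(1) _ v(2)] d by simp
    then have "stack_sort (L @ N # v) = stack_sort (L @ N # R)" "distinct (L @ N # v)"
      using v lt d by (auto simp: stack_sort_max_split)
    then show ?thesis using split.prems(2) by blast
  qed
  \<comment> \<open>For empty \<open>R\<close> this competitor moves the only child to the right;
    otherwise it serves to hang the left subtree inside the right one.\<close>
  have rotate: "stack_sort (N # L @ R) \<noteq> stack_sort (L @ N # R)" if "L \<noteq> []"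
  proof
    assume "stack_sort (N # L @ R) = stack_sort (L @ N # R)"
    then have "N # L @ R = L @ N # R" using split.prems(2) d by auto
    then show False using that d by (cases L) auto
  qed
  have front: "stack_sort (N # L @ R) = stack_sort (L @ R) @ [N]"
    using stack_sort_max_split[of "[]" "L @ R" N] lt by simp
  consider "L = []" "R = []" | "L = []" "R \<noteq> []" | "L \<noteq> []" "R = []" | "L \<noteq> []" "R \<noteq> []"
    by blast
  then show ?case
  proof cases
    case 1
    then show ?thesis using s by (simp add: binary_postorder.leaf)
  next
    case 2
    then have "stack_sort (R @ [N]) = stack_sort (L @ N # R)"
      using stack_sort_max_split[of R "[]" N] lt s by simp
    then have "R @ [N] = L @ N # R" using split.prems(2) d by auto
    then show ?thesis using 2 d by (cases R) auto
  next
    case 3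
    then show ?thesis using rotate front s by simp
  next
    case 4
    have L: "binary_postorder (stack_sort L)" and R: "binary_postorder (stack_sort R)"
      using split.IH uniq_L uniq_R 4 d by auto
    have "hd (stack_sort R) < last (stack_sort L)"
    proof (rule ccontr)
      assume "\<not> ?thesis"
      \<comment> \<open>The left side is the largest letter of \<open>L\<close>, so all of
        \<open>L\<close> lies below \<open>hd R\<close>, strictly by distinctness.\<close>
      then have "last (stack_sort L) \<le> hd R"
        using hd_stack_sort_le[of R] 4 d by simp
      then have "y \<le> hd R" if "y \<in> set L" for y
        using that Max_binary_postorder[OF L] set_stack_sort[of L] d
        by (metis List.finite_set Max_ge distinct_append order.trans)
      then have "y < hd R" if "y \<in> set L" for y
        using that 4 d by (metis disjoint_iff distinct_append hd_in_set less_le list.set_intros(2))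
      then have "stack_sort (L @ R) = stack_sort L @ stack_sort R"
        using 4 d by (intro stack_sort_append) auto
      then show False using rotate 4 front s by simp
    qed
    then show ?thesis unfolding s using L R d lt
      by (intro binary_postorder.node) (auto simp: set_stack_sort distinct_stack_sort)
  qed
qed

text \<open>The length 0 is excluded because the empty word is uniquely sorted but is not the
  reading of a tree.\<close>

lemma uniquely_sorted_iff:
  assumes "n > 0"
  shows "uniquely_sorted n w \<longleftrightarrow> binary_postorder w \<and> set w = {1..n}"
proof -
  have def': "uniquely_sorted n w \<longleftrightarrow> set w = {1..n} \<and> distinct w \<and>
      (\<exists>!v. (set v = {1..n} \<and> distinct v) \<and> stack_sort v = w)"
    by (simp only: uniquely_sorted_def permutations_of_set_def mem_Collect_eq conj_assoc)
  show ?thesis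
  proof
    assume "uniquely_sorted n w"
    then have w: "set w = {1..n}" and
      ex1: "\<exists>!v. (set v = {1..n} \<and> distinct v) \<and> stack_sort v = w"
      by (simp_all only: def')
    from ex1 obtain v where v: "distinct v" "set v = {1..n}" "stack_sort v = w"
      by (elim ex1E conjE)
    have "binary_postorder (stack_sort v)"
    proof (rule binary_postorder_if_unique_preimage[OF v(1)])
      fix u assume u: "distinct u" "stack_sort u = stack_sort v"
      then have "set u = {1..n}" using set_stack_sort[of u] v w by simp
      then show "u = v" using ex1 u v by metis
    qed (use v assms in auto)
    then show "binary_postorder w \<and> set w = {1..n}" using v w by simp
  next
    assume w: "binary_postorder w \<and> set w = {1..n}"
    then obtain v where v: "distinct v" "set v = {1..n}" "stack_sort v = w"
      using ex_stack_sort_eq_binary_postorder[of w] by metis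
    have "u = v" if "distinct u" "stack_sort u = w" for u
      by (rule stack_sort_binary_postorder_inj) (use that v w in simp_all)
    then have "\<exists>!v. (set v = {1..n} \<and> distinct v) \<and> stack_sort v = w"
      using v by blast
    then show "uniquely_sorted n w"
      using w binary_postorder_distinct[of w] unfolding def' by blast
  qed
qed

section \<open>Counting by the first letter\<close>

lemma sum_Pow_card:
  fixes f :: "nat \<Rightarrow> 'a::semiring_1"
  assumes "finite B"
  shows "(\<Sum>V\<in>Pow B. f (card V)) = (\<Sum>p\<le>card B. of_nat (card B choose p) * f p)"
proof -
  have "(\<Sum>V\<in>Pow B. f (card V)) =
      (\<Sum>p\<in>{..card B}. \<Sum>V\<in>{V \<in> Pow B. card V = p}. f (card V))"
    by (rule sum.group [symmetric]) (use assms in \<open>auto intro: card_mono\<close>)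
  also have "\<dots> = (\<Sum>p\<le>card B. of_nat (card B choose p) * f p)"
    using assms by (intro sum.cong) (simp_all add: n_subsets)
  finally show ?thesis .
qed

text \<open>The parts of \<open>U\<close> below and above \<open>x\<close> are chosen
  independently.\<close>

lemma sum_subsets_containing:
  fixes f :: "nat \<Rightarrow> nat \<Rightarrow> 'a::comm_semiring_1" and T :: "'b::linorder set"
  assumes "finite T" "x \<in> T"
  defines "B \<equiv> {y\<in>T. y < x}" and "A \<equiv> {y\<in>T. x < y}"
  shows "(\<Sum>U\<in>{U. U \<subseteq> T \<and> x \<in> U}. f (card {y\<in>U. y < x}) (card {y\<in>U. x < y})) =
    (\<Sum>p\<le>card B. \<Sum>q\<le>card A. of_nat ((card B choose p) * (card A choose q)) * f p q)"
proof -
  have fin: "finite A" "finite B" using assms by auto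
  have "(\<Sum>U\<in>{U. U \<subseteq> T \<and> x \<in> U}. f (card {y\<in>U. y < x}) (card {y\<in>U. x < y})) =
      (\<Sum>(V, W)\<in>Pow B \<times> Pow A. f (card V) (card W))"
    by (rule sum.reindex_bij_witness
          [of _ "\<lambda>(V, W). insert x (V \<union> W)" "\<lambda>U. ({y\<in>U. y < x}, {y\<in>U. x < y})"])
      (use assms(2) in \<open>auto simp: A_def B_def\<close>)
  also have "\<dots> = (\<Sum>V\<in>Pow B. \<Sum>W\<in>Pow A. f (card V) (card W))"
    by (simp add: sum.cartesian_product)
  also have "\<dots> = (\<Sum>p\<le>card B. of_nat (card B choose p) *
      (\<Sum>q\<le>card A. of_nat (card A choose q) * f p q))"
    by (simp only: sum_Pow_card[OF fin(1)] sum_Pow_card[OF fin(2),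
          of "\<lambda>p. \<Sum>q\<le>card A. of_nat (card A choose q) * f p q"])
  finally show ?thesis by (simp add: sum_distrib_left mult.assoc)
qed

text \<open>This is the index \<open>i - p + (j - q)\<close> of \<open>appell_mult\<close>; no
  subtraction truncates.\<close>

lemma card_Diff_split:
  fixes T :: "'a::linorder set"
  assumes "finite T" "U \<subseteq> T" "x \<in> U"
  shows "card (T - U) = card {y\<in>T. y < x} - card {y\<in>U. y < x} +
    (card {y\<in>T. x < y} - card {y\<in>U. x < y})"
proof -
  let ?B = "{y\<in>T. y < x} - {y\<in>U. y < x}" and ?A = "{y\<in>T. x < y} - {y\<in>U. x < y}"
  have fin: "finite U" using assms finite_subset by blast
  have "T - U = ?B \<union> ?A"
    using assms(2,3) by (auto simp: not_less order.order_iff_strict)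
  moreover have "card (?B \<union> ?A) = card ?B + card ?A"
    using assms(1) by (intro card_Un_disjoint) auto
  moreover have "card ?B = card {y\<in>T. y < x} - card {y\<in>U. y < x}"
    by (rule card_Diff_subset) (use fin assms(2) in auto)
  moreover have "card ?A = card {y\<in>T. x < y} - card {y\<in>U. x < y}"
    by (rule card_Diff_subset) (use fin assms(2) in auto)
  ultimately show ?thesis by (simp only:)
qed

text \<open>A new maximum raises the second argument at all other elements, hence \<open>f\<close>
  is arbitrary in the induction.\<close>

lemma sum_ranks:
  fixes f :: "nat \<Rightarrow> nat \<Rightarrow> 'a::comm_monoid_add" and V :: "'b::linorder set"
  assumes "finite V"
  shows "(\<Sum>w\<in>V. f (card {y\<in>V. y < w}) (card {y\<in>V. w < y})) =
    (\<Sum>s<card V. f s (card V - 1 - s))"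
  using assms
proof (induction V arbitrary: f rule: finite_linorder_max_induct)
  case (insert b V)
  have b: "b \<notin> V" using insert.hyps by auto
  have below_b: "{y\<in>insert b V. y < b} = V" and above_b: "{y\<in>insert b V. b < y} = {}"
    using insert.hyps by auto
  have below: "{y\<in>insert b V. y < w} = {y\<in>V. y < w}"
    and above: "{y\<in>insert b V. w < y} = insert b {y\<in>V. w < y}" if "w \<in> V" for w
    using insert.hyps that by (auto dest: order.asym)
  have "(\<Sum>w\<in>V. f (card {y\<in>insert b V. y < w}) (card {y\<in>insert b V. w < y})) =
      (\<Sum>w\<in>V. f (card {y\<in>V. y < w}) (Suc (card {y\<in>V. w < y})))"
  proof (rule sum.cong [OF refl])
    fix w assume "w \<in> V"
    then show "f (card {y\<in>insert b V. y < w}) (card {y\<in>insert b V. w < y}) =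
        f (card {y\<in>V. y < w}) (Suc (card {y\<in>V. w < y}))"
      unfolding below[OF \<open>w \<in> V\<close>] above[OF \<open>w \<in> V\<close>] using insert.hyps(1) b by simp
  qed
  also have "\<dots> = (\<Sum>s<card V. f s (Suc (card V - 1 - s)))"
    by (rule insert.IH)
  also have "\<dots> = (\<Sum>s<card V. f s (card V - s))"
    by (intro sum.cong) (auto simp: Suc_diff_Suc)
  finally show ?case
    unfolding sum.insert[OF insert.hyps(1) b] below_b above_b
    using insert.hyps(1) b by (simp add: add.commute)
qed simp

text \<open>Label sets other than intervals are needed for the subtrees.\<close>

definition binary_postorders :: "nat set \<Rightarrow> nat \<Rightarrow> nat list set" where
  "binary_postorders S x = {w. binary_postorder w \<and> set w = S \<and> hd w = x}"

lemma finite_binary_postorders: "finite S \<Longrightarrow> finite (binary_postorders S x)"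
  by (rule finite_subset[OF _ finite_permutations_of_set[of S]])
    (auto simp: binary_postorders_def permutations_of_set_def dest: binary_postorder_distinct)

text \<open>The maximum is the last letter; if it is also the first, the distinct word has length
  one.\<close>

lemma binary_postorders_Max:
  assumes "finite S" "x = Max S"
  shows "binary_postorders S x = (if S = {x} then {[x]} else {})"
proof -
  have *: "w = [x] \<and> S = {x}" if "w \<in> binary_postorders S x" for w
  proof -
    have w: "binary_postorder w" "set w = S" "hd w = x"
      using that by (auto simp: binary_postorders_def)
    then have "hd w = last w" using assms Max_binary_postorder by metis
    then have "w = [x]" using w binary_postorder_distinct[of w] binary_postorder_nonempty[of w]
      by (cases w) (auto split: if_splits)
    then show ?thesis using w by auto
  qed
  have "[x] \<in> binary_postorders {x} x"
    by (simp add: binary_postorders_def binary_postorder.leaf)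
  then have "S = {x} \<Longrightarrow> binary_postorders S x = {[x]}"
    and "S \<noteq> {x} \<Longrightarrow> binary_postorders S x = {}"
    using * by blast+
  then show ?thesis by presburger
qed

text \<open>\<open>U\<close> is the label set of the left subtree and \<open>w\<close> the first
  letter of the right one. As \<open>Max U\<close> is the last letter of the left reading,
  \<open>w < Max U\<close> is the junction condition.\<close>

lemma binary_postorders_rec:
  assumes "finite S" "x \<in> S" "x \<noteq> Max S"
  defines "T \<equiv> S - {Max S}"
  shows "binary_postorders S x = (\<Union>(U, w)\<in>(SIGMA U:{U. U \<subseteq> T \<and> x \<in> U}. {w\<in>T - U. w < Max U}).
    (\<lambda>(L, R). L @ R @ [Max S]) ` (binary_postorders U x \<times> binary_postorders (T - U) w))"
    (is "_ = ?rhs")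
proof (intro equalityI subsetI)
  fix w assume "w \<in> binary_postorders S x"
  then have w: "binary_postorder w" "set w = S" "hd w = x" by (auto simp: binary_postorders_def)
  have last: "Max S = last w" using Max_binary_postorder w by metis
  from w(1) show "w \<in> ?rhs"
  proof cases
    case (leaf a)
    then have "S = {x}" using w(2,3) by simp
    then show ?thesis using assms(3) by simp
  next
    case (node L R N)
    have ne: "L \<noteq> []" "R \<noteq> []" using node by (auto dest: binary_postorder_nonempty)
    have N: "N = Max S" using last node by simp
    have "set L \<union> set R = T" using node w(2) unfolding T_def N by auto
    moreover from this have "set R = T - set L" using node by auto
    moreover have "x \<in> set L" using w(3) node ne by auto
    moreover have "hd R \<in> T - set L" using calculation ne by (metis hd_in_set)
    moreover have "hd R < Max (set L)" using node Max_binary_postorder by metis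
    moreover have "L \<in> binary_postorders (set L) x" using node w(3) ne
      by (simp add: binary_postorders_def)
    moreover have "R \<in> binary_postorders (T - set L) (hd R)"
      using node calculation by (simp add: binary_postorders_def)
    ultimately show ?thesis using node(1) N
      by (intro UN_I[of "(set L, hd R)"]) auto
  qed
next
  fix w assume "w \<in> ?rhs"
  then obtain U v L R where U: "U \<subseteq> T" "x \<in> U" "v \<in> T - U" "v < Max U"
    and L: "binary_postorder L" "set L = U" "hd L = x"
    and R: "binary_postorder R" "set R = T - U" "hd R = v"
    and w: "w = L @ R @ [Max S]"
    by (auto simp: binary_postorders_def)
  have lt: "y < Max S" if "y \<in> T" for y
    using that assms by (auto simp: T_def less_le)
  have "binary_postorder w" unfolding w
  proof (rule binary_postorder.node)
    show "distinct (L @ R)" using L R by (auto dest: binary_postorder_distinct)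
    show "\<forall>y\<in>set L \<union> set R. y < Max S" using L R U lt by auto
    show "hd R < last L" using Max_binary_postorder[OF L(1)] L R U by simp
  qed (use L R in auto)
  moreover have "set w = insert (Max S) T" using w L R U by auto
  moreover have "Max S \<in> S" using assms(1,2) by (intro Max_in) auto
  ultimately have "set w = S" by (simp add: T_def insert_absorb)
  moreover note \<open>binary_postorder w\<close>
  moreover have "hd w = x" using w L by (simp add: binary_postorder_nonempty)
  ultimately show "w \<in> binary_postorders S x" by (simp add: binary_postorders_def)
qed

lemma card_binary_postorders_rec:
  assumes "finite S" "x \<in> S" "x \<noteq> Max S"
  defines "T \<equiv> S - {Max S}"
  shows "card (binary_postorders S x) = (\<Sum>U\<in>{U. U \<subseteq> T \<and> x \<in> U}. \<Sum>w\<in>{w\<in>T - U. w < Max U}.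
    card (binary_postorders U x) * card (binary_postorders (T - U) w))"
proof -
  let ?I = "SIGMA U:{U. U \<subseteq> T \<and> x \<in> U}. {w\<in>T - U. w < Max U}"
  let ?join = "\<lambda>(L, R). L @ R @ [Max S]"
  let ?P = "\<lambda>(U, w). binary_postorders U x \<times> binary_postorders (T - U) w"
  have fin: "finite T" "finite {U. U \<subseteq> T \<and> x \<in> U}"
    using assms(1) by (auto simp: T_def)
  \<comment> \<open>Unique splitting makes concatenation injective and the images for different
    \<open>(U, w)\<close> disjoint.\<close>
  have join_inj: "L = L' \<and> R = R' \<and> U = U' \<and> w = w'"
    if "(L, R) \<in> ?P (U, w)" "(L', R') \<in> ?P (U', w')" "(U, w) \<in> ?I" "(U', w') \<in> ?I"
      "?join (L, R) = ?join (L', R')" for L R L' R' U w U' w'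
  proof -
    have "L = L' \<and> R = R'"
      using that Max_binary_postorder[of L] Max_binary_postorder[of L']
      by (intro binary_postorder_split_unique) (auto simp: binary_postorders_def)
    then show ?thesis using that by (auto simp: binary_postorders_def)
  qed
  have "card (binary_postorders S x) = card (\<Union>i\<in>?I. ?join ` ?P i)"
    unfolding binary_postorders_rec[OF assms(1-3)] T_def by (simp add: case_prod_unfold)
  also have "\<dots> = (\<Sum>i\<in>?I. card (?join ` ?P i))"
  proof (rule card_UN_disjoint)
    show "finite ?I" using fin by (intro finite_SigmaI) auto
    show "\<forall>i\<in>?I. finite (?join ` ?P i)"
      using fin finite_subset by (fastforce intro!: finite_binary_postorders)
    show "\<forall>i\<in>?I. \<forall>j\<in>?I. i \<noteq> j \<longrightarrow> ?join ` ?P i \<inter> ?join ` ?P j = {}"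
      using join_inj by fast
  qed
  also have "\<dots> = (\<Sum>i\<in>?I. card (?P i))"
    by (intro sum.cong refl card_image) (use join_inj in \<open>force simp: inj_on_def\<close>)
  also have "\<dots> = (\<Sum>(U, w)\<in>?I. card (binary_postorders U x) * card (binary_postorders (T - U) w))"
    by (intro sum.cong refl) (auto simp: card_cartesian_product)
  also have "\<dots> = (\<Sum>U\<in>{U. U \<subseteq> T \<and> x \<in> U}. \<Sum>w\<in>{w\<in>T - U. w < Max U}.
    card (binary_postorders U x) * card (binary_postorders (T - U) w))"
    using fin by (subst sum.Sigma) auto
  finally show ?thesis .
qed

text \<open>The recursion is completed to a sum over all \<open>w\<close>, and the surplus with
  \<open>Max U < w\<close> is subtracted. These parts match the two terms of the recursion of
  \<open>appell\<close> in the second factor.\<close>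

theorem card_binary_postorders:
  assumes "finite S" "x \<in> S"
  shows "int (card (binary_postorders S x)) =
    umbral (appell (card {y\<in>S. y < x}) * appell (card {y\<in>S. x < y}))"
  using assms
proof (induction "card S" arbitrary: S x rule: less_induct)
  case less
  note fin = \<open>finite S\<close>
  show ?case
  proof (cases "x = Max S")
    case True
    then have above: "{y\<in>S. x < y} = {}" using fin by (auto simp: leD)
    have "S = {x} \<longleftrightarrow> {y\<in>S. y < x} = {}"
      using True less.prems by (auto simp: less_le)
    \<comment> \<open>The second factor is \<open>appell 0\<close>, so the functional is 1 exactly
      when the first one is too, that is, for the one-letter word.\<close>
    then have "card {y\<in>S. y < x} = 0 \<longleftrightarrow> S = {x}" using fin by simp
    then show ?thesis
      unfolding binary_postorders_Max[OF fin True] above by (simp add: umbral_appell)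
  next
    case False
    define T where "T = S - {Max S}"
    define B where "B = {y\<in>S. y < x}"
    \<comment> \<open>\<open>A\<close> omits \<open>Max S\<close>, so the second index of the claim
      is \<open>Suc (card A)\<close>.\<close>
    define A where "A = {y\<in>T. x < y}"
    define N where "N = (\<lambda>U x. int (card (binary_postorders U x)))"
    define a where "a = (\<lambda>i j. umbral (appell i * appell j))"
    have S: "Max S \<in> S" using Max_in[OF fin] less.prems by blast
    have x_less: "x < Max S" using less.prems False by (simp add: less_le)
    have T: "finite T" "x \<in> T" "card T < card S"
      using fin less.prems False S card_Diff1_less[OF fin S] by (simp_all add: T_def)
    have B_T: "B = {y\<in>T. y < x}" using x_less by (auto simp: B_def T_def)
    have above: "{y\<in>S. x < y} = insert (Max S) A" using x_less S by (auto simp: A_def T_def)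
    have fin': "finite A" "finite B" using fin T by (auto simp: A_def B_def)
    have card_above: "card {y\<in>S. x < y} = Suc (card A)"
      unfolding above using fin' by (subst card_insert_disjoint) (auto simp: A_def T_def)
    have IH: "N U w = a (card {y\<in>U. y < w}) (card {y\<in>U. w < y})" if "U \<subseteq> T" "w \<in> U" for U w
    proof -
      have "finite U" using that T finite_subset by blast
      moreover have "card U < card S" using card_mono[OF T(1) that(1)] T(3) by simp
      ultimately show ?thesis using less.hyps that by (simp add: N_def a_def)
    qed
    have fin_U: "finite {U. U \<subseteq> T \<and> x \<in> U}" using T by simp
    have "N S x = (\<Sum>U\<in>{U. U \<subseteq> T \<and> x \<in> U}. \<Sum>w\<in>{w\<in>T - U. w < Max U}. N U x * N (T - U) w)"
      unfolding N_def T_def card_binary_postorders_rec[OF less.prems False] by simp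
    also have "\<dots> = (\<Sum>U\<in>{U. U \<subseteq> T \<and> x \<in> U}. \<Sum>w\<in>T - U. N U x * N (T - U) w) -
        (\<Sum>U\<in>{U. U \<subseteq> T \<and> x \<in> U}. \<Sum>w\<in>{w\<in>T - U. Max U < w}. N U x * N (T - U) w)"
    proof -
      have "(\<Sum>w\<in>T - U. N U x * N (T - U) w) = (\<Sum>w\<in>{w\<in>T - U. w < Max U}. N U x * N (T - U) w) +
          (\<Sum>w\<in>{w\<in>T - U. Max U < w}. N U x * N (T - U) w)"
        if U: "U \<subseteq> T" "x \<in> U" for U
      proof -
        have "Max U \<in> U" using U T finite_subset by (intro Max_in) auto
        then have "{w\<in>T - U. \<not> w < Max U} = {w\<in>T - U. Max U < w}"
          by (auto simp: not_less less_le)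
        then show ?thesis
          using T sum.Int_Diff[of "T - U" "\<lambda>w. N U x * N (T - U) w" "{w. w < Max U}"]
          by (simp add: Int_def set_diff_eq)
      qed
      then show ?thesis by (simp add: sum_subtractf [symmetric])
    qed
    \<comment> \<open>Without the junction condition \<open>w\<close> takes every rank in
      \<open>T - U\<close>, which gives the inner sum of
      \<open>umbral_X_appell_mult\<close>.\<close>
    also have "(\<Sum>U\<in>{U. U \<subseteq> T \<and> x \<in> U}. \<Sum>w\<in>T - U. N U x * N (T - U) w) =
        umbral ([:0, 1:] * (appell (card B) * appell (card A)))"
    proof -
      define g where "g = (\<lambda>p q. a p q *
        (\<Sum>s<card B - p + (card A - q). a s (card B - p + (card A - q) - 1 - s)))"
      have "(\<Sum>w\<in>T - U. N U x * N (T - U) w) =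
          a (card {y\<in>U. y < x}) (card {y\<in>U. x < y}) *
          (\<Sum>s<card B - card {y\<in>U. y < x} + (card A - card {y\<in>U. x < y}).
            a s (card B - card {y\<in>U. y < x} + (card A - card {y\<in>U. x < y}) - 1 - s))"
        if U: "U \<subseteq> T" "x \<in> U" for U
      proof -
        have card: "card (T - U) =
          card B - card {y\<in>U. y < x} + (card A - card {y\<in>U. x < y})"
          using card_Diff_split[OF T(1) U] by (simp add: B_T A_def)
        have "(\<Sum>w\<in>T - U. N U x * N (T - U) w) = N U x * (\<Sum>w\<in>T - U. N (T - U) w)"
          by (simp add: sum_distrib_left)
        also have "(\<Sum>w\<in>T - U. N (T - U) w) =
            (\<Sum>w\<in>T - U. a (card {y\<in>T - U. y < w}) (card {y\<in>T - U. w < y}))"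
          by (intro sum.cong refl IH) auto
        also have "\<dots> = (\<Sum>s<card (T - U). a s (card (T - U) - 1 - s))"
          using T by (intro sum_ranks) auto
        finally show ?thesis unfolding card using IH[OF U] by simp
      qed
      then have "(\<Sum>U\<in>{U. U \<subseteq> T \<and> x \<in> U}. \<Sum>w\<in>T - U. N U x * N (T - U) w) =
        (\<Sum>U\<in>{U. U \<subseteq> T \<and> x \<in> U}. g (card {y\<in>U. y < x}) (card {y\<in>U. x < y}))"
        by (intro sum.cong) (auto simp: g_def)
      also have "\<dots> = umbral ([:0, 1:] * (appell (card B) * appell (card A)))"
        unfolding sum_subsets_containing[OF T(1,2)]
        unfolding umbral_X_appell_mult B_T [symmetric]
          A_def [symmetric] g_def a_def
        by (simp only: mult.assoc)
      finally show ?thesis .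
    qed
    also have "(\<Sum>U\<in>{U. U \<subseteq> T \<and> x \<in> U}. \<Sum>w\<in>{w\<in>T - U. Max U < w}. N U x * N (T - U) w) =
        (\<Sum>t<card A. umbral (appell (card B) * appell t * appell (card A - 1 - t)))"
    proof -
      \<comment> \<open>When \<open>U\<close> lies below \<open>w\<close>, the letters of
        \<open>T - U\<close> above \<open>w\<close> do not depend on \<open>U\<close>, so the third
        factor is constant.\<close>
      have inner: "(\<Sum>U\<in>{U. U \<subseteq> {y\<in>T. y < w} \<and> x \<in> U}. N U x * N (T - U) w) =
          umbral (appell (card B) * appell (card {y\<in>A. y < w}) * appell (card {y\<in>A. w < y}))"
        if w: "w \<in> A" for w
      proof -
        let ?T = "{y\<in>T. y < w}"
        define g where "g = (\<lambda>p q. a p q *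
          a (card B - p + (card {y\<in>A. y < w} - q)) (card {y\<in>A. w < y}))"
        have Tw: "finite ?T" "x \<in> ?T" using T w by (auto simp: A_def)
        have B': "{y\<in>?T. y < x} = B" and A': "{y\<in>?T. x < y} = {y\<in>A. y < w}"
          using w by (auto simp: B_T A_def)
        have "N U x * N (T - U) w = a (card {y\<in>U. y < x}) (card {y\<in>U. x < y}) *
            a (card B - card {y\<in>U. y < x} + (card {y\<in>A. y < w} - card {y\<in>U. x < y}))
              (card {y\<in>A. w < y})"
          if U: "U \<subseteq> ?T" "x \<in> U" for U
        proof -
          have "{y\<in>T - U. y < w} = ?T - U" by auto
          then have below: "card {y\<in>T - U. y < w} =
            card B - card {y\<in>U. y < x} + (card {y\<in>A. y < w} - card {y\<in>U. x < y})"
            using card_Diff_split[OF Tw(1) U] by (simp only: A' B')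
          have above: "{y\<in>T - U. w < y} = {y\<in>A. w < y}" using U w by (auto simp: A_def)
          have "U \<subseteq> T" "w \<in> T - U" using U w by (auto simp: A_def)
          then show ?thesis using IH[of U x] IH[of "T - U" w] U below above by simp
        qed
        then have "(\<Sum>U\<in>{U. U \<subseteq> ?T \<and> x \<in> U}. N U x * N (T - U) w) =
            (\<Sum>U\<in>{U. U \<subseteq> ?T \<and> x \<in> U}. g (card {y\<in>U. y < x}) (card {y\<in>U. x < y}))"
          by (intro sum.cong) (auto simp: g_def)
        also have "\<dots> = umbral (appell (card B) * appell (card {y\<in>A. y < w}) *
            appell (card {y\<in>A. w < y}))"
          unfolding sum_subsets_containing[OF Tw]
          unfolding umbral_appell_mult3 B' A' g_def a_def
          by (simp only: mult.assoc)
        finally show ?thesis .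
      qed
      \<comment> \<open>\<open>Max U < w\<close> puts all of \<open>U\<close>, including
        \<open>x\<close>, below \<open>w\<close>; hence \<open>w\<close> is in \<open>A\<close> and
        the sums can be exchanged.\<close>
      have "(\<Sum>U\<in>{U. U \<subseteq> T \<and> x \<in> U}. \<Sum>w\<in>{w\<in>T - U. Max U < w}. N U x * N (T - U) w) =
          (\<Sum>U\<in>{U. U \<subseteq> T \<and> x \<in> U}. \<Sum>w\<in>{w\<in>A. U \<subseteq> {y\<in>T. y < w}}. N U x * N (T - U) w)"
      proof (intro sum.cong refl)
        fix U assume "U \<in> {U. U \<subseteq> T \<and> x \<in> U}"
        then have U: "U \<subseteq> T" "x \<in> U" "finite U" using T(1) by (auto intro: finite_subset)
        then have "Max U < w \<longleftrightarrow> (\<forall>y\<in>U. y < w)" for w by (intro Max_less_iff) auto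
        then show "{w\<in>T - U. Max U < w} = {w\<in>A. U \<subseteq> {y\<in>T. y < w}}"
          using U by (auto simp: A_def)
      qed
      also have "\<dots> = (\<Sum>w\<in>A. \<Sum>U\<in>{U\<in>{U. U \<subseteq> T \<and> x \<in> U}. U \<subseteq> {y\<in>T. y < w}}. N U x * N (T - U) w)"
        using fin_U fin'(1) by (rule sum.swap_restrict)
      also have "\<dots> = (\<Sum>w\<in>A. \<Sum>U\<in>{U. U \<subseteq> {y\<in>T. y < w} \<and> x \<in> U}. N U x * N (T - U) w)"
        by (intro sum.cong) auto
      also have "\<dots> = (\<Sum>w\<in>A. umbral (appell (card B) * appell (card {y\<in>A. y < w}) *
          appell (card {y\<in>A. w < y})))"
        by (intro sum.cong refl inner)
      also have "\<dots> = (\<Sum>t<card A. umbral (appell (card B) * appell t * appell (card A - 1 - t)))"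
        by (rule sum_ranks[OF fin'(1),
              of "\<lambda>t v. umbral (appell (card B) * appell t * appell v)"])
      finally show ?thesis .
    qed
    also have "umbral ([:0, 1:] * (appell (card B) * appell (card A))) -
        (\<Sum>t<card A. umbral (appell (card B) * appell t * appell (card A - 1 - t))) =
        umbral (appell (card B) * appell (Suc (card A)))"
    proof -
      have "appell (card B) * appell (Suc (card A)) = [:0, 1:] * (appell (card B) * appell (card A)) -
          (\<Sum>t<card A. appell (card B) * appell t * appell (card A - 1 - t))"
        by (simp add: appell.simps sum_distrib_left algebra_simps)
      then show ?thesis by (simp only: umbral_diff umbral_sum)
    qed
    finally show ?thesis
      unfolding card_above N_def B_def .
  qed
qed

section \<open>Unimodality of the first-letter counts\<close>

lemma uniquely_sorted_count_eq:
  assumes "l \<in> {1..n}"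
  shows "int (uniquely_sorted_count n l) = umbral (appell (l - 1) * appell (n - l))"
proof -
  have "{w. uniquely_sorted n w \<and> hd w = l} = binary_postorders {1..n} l"
    using assms by (auto simp: uniquely_sorted_iff binary_postorders_def)
  moreover have "{y\<in>{1..n}. y < l} = {1..<l}" "{y\<in>{1..n}. l < y} = {l<..n}"
    using assms by auto
  ultimately show ?thesis
    unfolding uniquely_sorted_count_def using card_binary_postorders[of "{1..n}" l] assms by simp
qed

theorem theorem1p1:
  fixes k :: nat
  shows "unimodal (uniquely_sorted_count (2 * k + 1)) (2 * k + 1)"
proof -
  let ?n = "2 * k + 1"
  have step: "int (uniquely_sorted_count ?n (Suc i)) = umbral (appell i * appell (2 * k - i))"
    if "i \<le> 2 * k" for i
    using uniquely_sorted_count_eq[of "Suc i" ?n] that by simp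
  \<comment> \<open>For \<open>i < k\<close> the indices \<open>i\<close> and
    \<open>2 * k - i\<close> differ by at least two, so a balancing step applies.\<close>
  have up: "uniquely_sorted_count ?n (Suc i) \<le> uniquely_sorted_count ?n (Suc (Suc i))"
    if "i < k" for i
  proof -
    have "2 * k - i = Suc (2 * k - Suc i)" using that by simp
    then have "int (uniquely_sorted_count ?n (Suc i)) \<le> int (uniquely_sorted_count ?n (Suc (Suc i)))"
      using umbral_appell_mult_mono[of i "2 * k - Suc i"] that step[of i] step[of "Suc i"] by simp
    then show ?thesis by simp
  qed
  \<comment> \<open>Commuting the two factors reflects the sequence about its middle position
    \<open>k + 1\<close>, the peak.\<close>
  have sym: "uniquely_sorted_count ?n (Suc i) = uniquely_sorted_count ?n (Suc (2 * k - i))"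
    if "i \<le> 2 * k" for i
    using step[of i] step[of "2 * k - i"] that by (simp add: mult.commute)
  show ?thesis
    unfolding unimodal_def
  proof (intro bexI[of _ "k + 1"] conjI ballI)
    fix i assume "i \<in> {1..<k + 1}"
    then show "uniquely_sorted_count ?n i \<le> uniquely_sorted_count ?n (i + 1)"
      using up[of "i - 1"] by (cases i) simp_all
  next
    fix i assume i: "i \<in> {k + 1..<?n}"
    then have "Suc (2 * k - (i - 1)) = Suc (Suc (2 * k - i))" "2 * k - i < k" by auto
    then show "uniquely_sorted_count ?n (i + 1) \<le> uniquely_sorted_count ?n i"
      using up[of "2 * k - i"] sym[of i] sym[of "i - 1"] i by simp
  qed simp
qed

end
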